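(* Let $z_0\in\mathbb{C}$, $r>0$, and let $f$ be harmonic in $D=\{z\in\mathbb{C}:0<|z-z_0|<r\}$ with $$f(z)=\sum_{k=-n}^\infty a_k(z-z_0)^k+\overline{\sum_{k=-n}^\infty b_k(z-z_0)^k}+2A\log|z-z_0|,\qquad z\in D,$$ where $n\ge1$, $A\in\mathbb{C}$ and $|a_{-n}|\neq|b_{-n}|$. For $\eta\in\mathbb{C}$ put $c=\eta-(a_0+\overline{b_0})$, suppose $c\neq0$, and let $\zeta_1,\dots,\zeta_n$ be the $n$ solutions of $$(\zeta-z_0)^n=\frac{|a_{-n}|^2-|b_{-n}|^2}{\overline{a_{-n}}\,c-\overline{b_{-n}}\,\overline{c}}.$$ Then for all $\eta$ with $|c|$ (equivalently $|\eta|$) sufficiently large: (1) there exist exactly $n$ solutions of $f(z)=\eta$ near $z_0$; (2) the set $S=\{\zeta_1,\dots,\zeta_n\}$ is a prediction set for the solutions in (1), i.e., for each $j$ the harmonic Newton iteration for $f-\eta$ started at $\zeta_j$ converges, and $\zeta_j\mapsto H^\infty_{f-\eta}(\zeta_j)$ is a bijection from $S$ onto the set of these $n$ solutions.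
   Context: A harmonic mapping is a function $f$ with $\Delta f=4\partial_{\bar z}\partial_z f=0$, with Wirtinger derivatives $\partial_z=\frac12(\partial_x-i\partial_y)$, $\partial_{\bar z}=\frac12(\partial_x+i\partial_y)$. For a harmonic mapping $F$, the harmonic Newton map is $$H_F(z)=z-\frac{\overline{\partial_zF(z)}\,F(z)-\partial_{\bar z}F(z)\,\overline{F(z)}}{|\partial_zF(z)|^2-|\partial_{\bar z}F(z)|^2},$$ defined where the Jacobian $|\partial_zF|^2-|\partial_{\bar z}F|^2$ is nonzero (this is Newton's method for $F$ viewed as a map $\mathbb{R}^2\to\mathbb{R}^2$). The harmonic Newton iteration is $z_k=H_F(z_{k-1})$, and $H_F^\infty(z_0)=\lim_{k\to\infty}z_k$ when this limit exists. *)

theory Defs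
  imports "HOL-Analysis.Analysis"
begin

text \<open>Wirtinger derivatives via the real Frechet derivative L of F at z:
  F_x = L 1, F_y = L i, so d_z F = (F_x - i F_y)/2 and d_zbar F = (F_x + i F_y)/2.\<close>

definition wirt_z :: "(complex \<Rightarrow> complex) \<Rightarrow> complex \<Rightarrow> complex" where
  "wirt_z F z = (frechet_derivative F (at z) 1 - \<i> * frechet_derivative F (at z) \<i>) / 2"

definition wirt_zbar :: "(complex \<Rightarrow> complex) \<Rightarrow> complex \<Rightarrow> complex" where
  "wirt_zbar F z = (frechet_derivative F (at z) 1 + \<i> * frechet_derivative F (at z) \<i>) / 2"

definition harm_jac :: "(complex \<Rightarrow> complex) \<Rightarrow> complex \<Rightarrow> real" where
  "harm_jac F z = (cmod (wirt_z F z))\<^sup>2 - (cmod (wirt_zbar F z))\<^sup>2"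

text \<open>Harmonic Newton map (meaningful where harm_jac F z is nonzero).\<close>
definition harm_newton :: "(complex \<Rightarrow> complex) \<Rightarrow> complex \<Rightarrow> complex" where
  "harm_newton F z = z - (cnj (wirt_z F z) * F z - wirt_zbar F z * cnj (F z))
                          / complex_of_real (harm_jac F z)"

definition harm_newton_lim :: "(complex \<Rightarrow> complex) \<Rightarrow> complex \<Rightarrow> complex" where
  "harm_newton_lim F z0 = lim (\<lambda>k. (harm_newton F ^^ k) z0)"

end

theory Submission
  imports Defs
begin

text \<open>
  Put \<open>w = z - z0\<close>. The leading part of \<open>f\<close> is \<open>T (1 / w ^ n)\<close> for the real-linear bijection
  \<open>T u = \<alpha> u + cnj \<beta> cnj u\<close>, and \<open>f - \<eta> = T (1 / w ^ n) + g w - c\<close> where \<open>g = o(|w|^(-n))\<close> and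
  \<open>Dg = o(|w|^(-n-1))\<close>; the starting points are the solutions of \<open>T (1 / w ^ n) = c\<close>. Newton's method is
  invariant under composition with real-linear bijections, so near a starting point \<open>\<zeta>\<close> one may
  normalise so that the derivative is close to the identity on a ball of radius \<open>\<delta> |\<zeta> - z0|\<close>, with
  \<open>\<delta>\<close> depending on \<open>n\<close> only. There \<open>z - P (F z)\<close> is a contraction, which gives a unique zero,
  and each Newton step at least halves the distance to that zero. Conversely, any small solution
  satisfies \<open>w ^ n T\<^sup>-\<^sup>1 c \<approx> 1\<close>, so \<open>w\<close> lies in one of these balls.
\<close>

section \<open>The harmonic Newton step as the solution of a real-linear equation\<close>

lemma linear_wirtinger:
  fixes L :: "complex \<Rightarrow> complex"
  assumes "linear L"
  shows "L v = (L 1 - \<i> * L \<i>) / 2 * v + (L 1 + \<i> * L \<i>) / 2 * cnj v"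
proof -
  have "L v = L (Re v *\<^sub>R 1 + Im v *\<^sub>R \<i>)"
    by (rule arg_cong[where f = L]) (simp add: complex_eq_iff)
  also have "\<dots> = Re v *\<^sub>R L 1 + Im v *\<^sub>R L \<i>"
    using assms by (simp add: linear_add linear_scale)
  also have "\<dots> = (L 1 - \<i> * L \<i>) / 2 * v + (L 1 + \<i> * L \<i>) / 2 * cnj v"
    by (simp add: complex_eq_iff algebra_simps) (simp add: field_simps)
  finally show ?thesis .
qed

text \<open>Cramer's rule: the map sending \<open>v\<close> to \<open>p * v + q * cnj v\<close> has
  as adjugate the map sending \<open>y\<close> to \<open>cnj p * y - q * cnj y\<close>, and its real
  determinant is \<open>(cmod p)^2 - (cmod q)^2\<close>.\<close>

lemma wirtinger_solve:
  fixes p q y :: complex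
  shows "p * (cnj p * y - q * cnj y) + q * cnj (cnj p * y - q * cnj y)
    = of_real ((cmod p)\<^sup>2 - (cmod q)\<^sup>2) * y"
  by (simp add: complex_norm_square algebra_simps del: of_real_power)

text \<open>Later arguments use the Newton map only through this linear equation, so Wirtinger
  derivatives can be forgotten from here on.\<close>

lemma harm_newton_solves:
  fixes F :: "complex \<Rightarrow> complex"
  assumes der: "(F has_derivative L) (at z)"
    and inj: "\<And>v. L v = 0 \<Longrightarrow> v = 0"
  shows "harm_jac F z \<noteq> 0" and "L (z - harm_newton F z) = F z"
proof -
  define p where "p = wirt_z F z"
  define q where "q = wirt_zbar F z"
  have fd: "frechet_derivative F (at z) = L"
    using der frechet_derivative_at by metis
  have L: "L v = p * v + q * cnj v" for v
    unfolding p_def q_def wirt_z_def wirt_zbar_def fd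
    by (rule linear_wirtinger) (use der has_derivative_linear in blast)
  have J: "harm_jac F z = (cmod p)\<^sup>2 - (cmod q)\<^sup>2"
    by (simp add: harm_jac_def p_def q_def)
  \<comment> \<open>With zero determinant, \<open>L\<close> kills the image of its adjugate, so by
    injectivity the adjugate vanishes. Evaluating it at 1 and \<open>\<i>\<close> forces
    \<open>p = q = 0\<close>, which contradicts injectivity at 1.\<close>
  show nz: "harm_jac F z \<noteq> 0"
  proof
    assume "harm_jac F z = 0"
    then have "L (cnj p * y - q * cnj y) = 0" for y
      unfolding L wirtinger_solve J[symmetric] by simp
    then have *: "cnj p * y - q * cnj y = 0" for y
      using inj by blast
    from *[of 1] *[of \<i>] have "cnj p = 0" "q = 0"
      by (auto simp: complex_eq_iff)
    then have "L 1 = 0"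
      by (simp add: L)
    then show False
      using inj by fastforce
  qed
  have "z - harm_newton F z = (cnj p * F z - q * cnj (F z)) / of_real (harm_jac F z)"
    by (simp add: harm_newton_def p_def q_def)
  then have "L (z - harm_newton F z)
      = (p * (cnj p * F z - q * cnj (F z)) + q * cnj (cnj p * F z - q * cnj (F z)))
        / of_real (harm_jac F z)"
    by (simp add: L add_divide_distrib)
  also have "\<dots> = F z"
    unfolding wirtinger_solve J[symmetric] using nz by simp
  finally show "L (z - harm_newton F z) = F z" .
qed

section \<open>Convergence of Newton's method near an approximate zero\<close>

text \<open>\<open>P\<close> is an approximate inverse of all derivatives \<open>L z\<close> on the
  ball at once. Zeros of \<open>F\<close> there are the fixed points of \<open>z - P (F z)\<close>,
  a contraction by \<open>near_id\<close>. The Newton map itself does not involve \<open>P\<close>,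
  which serves only to estimate its error.\<close>

lemma harm_newton_ball:
  fixes F :: "complex \<Rightarrow> complex" and P :: "complex \<Rightarrow> complex"
  assumes P: "bounded_linear P" and P0: "\<And>y. P y = 0 \<Longrightarrow> y = 0"
    and d: "d > 0"
    and der: "\<And>z. z \<in> cball \<zeta> d \<Longrightarrow> (F has_derivative L z) (at z)"
    and near_id: "\<And>z v. z \<in> cball \<zeta> d \<Longrightarrow> cmod (P (L z v) - v) \<le> 1/5 * cmod v"
    and start: "cmod (P (F \<zeta>)) \<le> 2/5 * d"
  obtains x where "x \<in> cball \<zeta> d" "F x = 0"
    "\<And>y. y \<in> cball \<zeta> d \<Longrightarrow> F y = 0 \<Longrightarrow> y = x"
    "\<And>k. (harm_newton F ^^ k) \<zeta> \<in> cball \<zeta> d"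
    "\<And>k. harm_jac F ((harm_newton F ^^ k) \<zeta>) \<noteq> 0"
    "(\<lambda>k. (harm_newton F ^^ k) \<zeta>) \<longlonglongrightarrow> x"
proof -
  interpret P: bounded_linear P by fact
  define \<phi> where "\<phi> = (\<lambda>z. z - P (F z))"
  have lip: "cmod (\<phi> x - \<phi> y) \<le> 1/5 * cmod (x - y)"
    if "x \<in> cball \<zeta> d" "y \<in> cball \<zeta> d" for x y
  proof (rule differentiable_bound[where S = "cball \<zeta> d"])
    show "(\<phi> has_derivative (\<lambda>v. v - P (L z v))) (at z within cball \<zeta> d)"
      if "z \<in> cball \<zeta> d" for z
      unfolding \<phi>_def
      by (rule has_derivative_diff[OF has_derivative_ident
            P.has_derivative[OF has_derivative_at_withinI[OF der[OF that]]]])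
    show "onorm (\<lambda>v. v - P (L z v)) \<le> 1/5" if "z \<in> cball \<zeta> d" for z
      by (rule onorm_le) (use near_id[OF that] norm_minus_commute in metis)
  qed (use that in auto)
  have sub: "cball \<zeta> (d/2) \<subseteq> cball \<zeta> d"
    using d by auto
  \<comment> \<open>The fixed point is sought at half the radius so that the ball of radius
    \<open>d/2\<close> around it, where the iterates will stay, still lies in
    \<open>cball \<zeta> d\<close>. The self-map property rests on 1/5 * d/2 + 2/5 * d =
    d/2.\<close>
  have "\<exists>!x\<in>cball \<zeta> (d/2). \<phi> x = x"
  proof (rule Banach_fix)
    show "\<phi> ` cball \<zeta> (d/2) \<subseteq> cball \<zeta> (d/2)"
    proof
      fix y assume "y \<in> \<phi> ` cball \<zeta> (d/2)"
      then obtain z where z: "z \<in> cball \<zeta> (d/2)" "y = \<phi> z"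
        by auto
      have "cmod (\<phi> z - \<zeta>) = cmod ((\<phi> z - \<phi> \<zeta>) - P (F \<zeta>))"
        by (simp add: \<phi>_def algebra_simps)
      also have "\<dots> \<le> cmod (\<phi> z - \<phi> \<zeta>) + cmod (P (F \<zeta>))"
        by (rule norm_triangle_ineq4)
      also have "\<dots> \<le> 1/5 * cmod (z - \<zeta>) + 2/5 * d"
        using lip[of z \<zeta>] z sub d start by auto
      also have "\<dots> \<le> d/2"
        using z by (simp add: dist_norm norm_minus_commute)
      finally show "y \<in> cball \<zeta> (d/2)"
        using z by (simp add: dist_norm norm_minus_commute)
    qed
    show "dist (\<phi> x) (\<phi> y) \<le> 1/5 * dist x y"
      if "x \<in> cball \<zeta> (d/2)" "y \<in> cball \<zeta> (d/2)" for x y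
      using lip that sub unfolding dist_norm by blast
  qed (use d in \<open>auto simp: complete_eq_closed\<close>)
  then obtain x where x: "x \<in> cball \<zeta> (d/2)" "\<phi> x = x"
    by blast
  have xd: "x \<in> cball \<zeta> d"
    using x sub by blast
  have Fx: "F x = 0"
    using x(2) P0 by (simp add: \<phi>_def)
  have uniq: "y = x" if "y \<in> cball \<zeta> d" "F y = 0" for y
  proof -
    have "\<phi> y = y"
      using that by (simp add: \<phi>_def P.zero)
    then have "cmod (y - x) \<le> 1/5 * cmod (y - x)"
      using lip[OF that(1) xd] x(2) by simp
    then show ?thesis
      by simp
  qed
  have below: "4/5 * cmod v \<le> cmod (P (L z v))" if "z \<in> cball \<zeta> d" for z v
    using near_id[OF that, of v] norm_triangle_ineq2[of v "P (L z v)"]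
    by (simp add: norm_minus_commute)
  have inj: "v = 0" if "z \<in> cball \<zeta> d" "L z v = 0" for z v
    using below[OF that(1), of v] that(2) by (simp add: P.zero)
  have halve: "cmod (harm_newton F z - x) \<le> 1/2 * cmod (z - x)" if z: "z \<in> cball \<zeta> d" for z
  proof -
    let ?N = "harm_newton F z"
    have lin: "linear (L z)"
      using der[OF z] has_derivative_linear by blast
    have "L z (?N - x) = L z ((z - x) - (z - ?N))"
      by simp
    also have "\<dots> = L z (z - x) - F z"
      unfolding linear_diff[OF lin, of "z - x"]
      using harm_newton_solves(2)[OF der[OF z]] inj[OF z] by simp
    \<comment> \<open>Substituting \<open>P (F z) = z - \<phi> z\<close> splits the error into the
      defect of \<open>P\<close> after \<open>L z\<close> from the identity and a difference of
      values of \<open>\<phi>\<close>. Each is at most 1/5 of \<open>cmod (z - x)\<close>, and the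
      lower bound 4/5 from \<open>below\<close> turns the sum 2/5 into the factor 1/2.\<close>
    finally have "P (L z (?N - x)) = (P (L z (z - x)) - (z - x)) + (\<phi> z - \<phi> x)"
      by (simp add: \<phi>_def P.diff Fx P.zero)
    then have "cmod (P (L z (?N - x))) \<le> cmod (P (L z (z - x)) - (z - x)) + cmod (\<phi> z - \<phi> x)"
      by (simp add: norm_triangle_ineq)
    also have "\<dots> \<le> 2/5 * cmod (z - x)"
      using near_id[OF z, of "z - x"] lip[OF z xd] by simp
    finally show ?thesis
      using below[OF z, of "?N - x"] by simp
  qed
  have close_in: "z \<in> cball \<zeta> d" if "cmod (z - x) \<le> d/2" for z
    using that x(1) dist_triangle[of \<zeta> z x] by (simp add: dist_norm norm_minus_commute)
  let ?z = "\<lambda>k. (harm_newton F ^^ k) \<zeta>"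
  have it: "cmod (?z k - x) \<le> d/2 * (1/2) ^ k" for k
  proof (induction k)
    case 0
    then show ?case
      using x(1) by (simp add: dist_norm)
  next
    case (Suc k)
    have "d/2 * (1/2) ^ k \<le> d/2 * 1"
      using d by (intro mult_left_mono power_le_one) auto
    then have "?z k \<in> cball \<zeta> d"
      using Suc close_in by fastforce
    from halve[OF this] Suc show ?case
      by simp
  qed
  have mem: "?z k \<in> cball \<zeta> d" for k
  proof -
    have "d/2 * (1/2) ^ k \<le> d/2 * 1"
      using d by (intro mult_left_mono power_le_one) auto
    then show ?thesis
      using it[of k] close_in by fastforce
  qed
  have "(\<lambda>k. d/2 * (1/2) ^ k) \<longlonglongrightarrow> d/2 * 0"
    by (intro tendsto_intros LIMSEQ_power_zero) auto
  then have "(\<lambda>k. d/2 * (1/2) ^ k) \<longlonglongrightarrow> 0"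
    by simp
  with always_eventually[OF allI[OF it]] have "(\<lambda>k. ?z k - x) \<longlonglongrightarrow> 0"
    by (rule Lim_null_comparison)
  then have "?z \<longlonglongrightarrow> x"
    by (rule LIM_zero_cancel)
  moreover have "harm_jac F (?z k) \<noteq> 0" for k
    using harm_newton_solves(1)[OF der[OF mem]] inj[OF mem] by blast
  ultimately show ?thesis
    using that[of x] xd Fx uniq mem by blast
qed

section \<open>The dominant pole: starting points, their balls and the zeros in them\<close>

text \<open>By continuity of the principal branch of the root at 1, the root \<open>p\<close> of
  \<open>x ^ n\<close> is close to 1. Then \<open>x / p\<close> is an exact root of unity, and its
  distance from \<open>x\<close> equals \<open>cmod (p - 1)\<close>.\<close>

lemma near_root_of_unity:
  fixes n :: nat and \<delta> :: real
  assumes "n \<ge> 1" "\<delta> > 0"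
  obtains \<epsilon> where "\<epsilon> > 0"
    "\<And>x::complex. cmod (x ^ n - 1) \<le> \<epsilon> \<Longrightarrow> \<exists>\<xi>. \<xi> ^ n = 1 \<and> cmod (x - \<xi>) \<le> \<delta>"
proof -
  have "isCont (\<lambda>y. exp (Ln y / of_nat n)) 1"
    by (intro continuous_intros) (use assms in auto)
  then obtain e where e: "e > 0"
    "\<And>y. dist y 1 < e \<Longrightarrow> dist (exp (Ln y / of_nat n)) (exp (Ln 1 / of_nat n)) < \<delta>"
    unfolding continuous_at_eps_delta using \<open>\<delta> > 0\<close> by blast
  show ?thesis
  proof (rule that)
    \<comment> \<open>The bound 1/2 keeps \<open>x ^ n\<close> away from 0, and halving
      \<open>e\<close> yields the strict inequality that continuity asks for.\<close>
    show "min (e/2) (1/2) > 0"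
      using e by simp
    fix x :: complex
    assume x: "cmod (x ^ n - 1) \<le> min (e/2) (1/2)"
    define p where "p = exp (Ln (x ^ n) / of_nat n)"
    have "x ^ n \<noteq> 0"
    proof
      assume "x ^ n = 0"
      then have "cmod (x ^ n - 1) = 1"
        by (simp only: diff_0 norm_minus_cancel norm_one)
      then show False
        using x by linarith
    qed
    then have pn: "p ^ n = x ^ n"
      using assms by (simp add: p_def exp_of_nat_mult[symmetric])
    have p0: "p \<noteq> 0"
      by (simp add: p_def)
    have "cmod (p - 1) \<le> \<delta>"
      using e(2)[of "x ^ n"] x e(1) by (simp add: dist_norm p_def)
    moreover have u: "(x / p) ^ n = 1"
      using pn \<open>x ^ n \<noteq> 0\<close> by (simp add: power_divide)
    moreover have "cmod (x / p) = 1"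
      using u assms power_eq_1_iff by (metis not_one_le_zero)
    moreover have "x - x / p = x / p * (p - 1)"
      using p0 by (simp add: field_simps)
    ultimately show "\<exists>\<xi>. \<xi> ^ n = 1 \<and> cmod (x - \<xi>) \<le> \<delta>"
      by (metis mult_1 norm_mult)
  qed
qed

lemma has_field_derivative_inverse_power:
  fixes z :: "'a::real_normed_field"
  assumes "z - a \<noteq> 0"
  shows "((\<lambda>w. 1 / (w - a) ^ n) has_field_derivative - (of_nat n / (z - a) ^ (n + 1))) (at z)"
proof (cases n)
  case (Suc m)
  have "((\<lambda>w. (w - a) ^ n) has_field_derivative of_nat n * (z - a) ^ m) (at z)"
  proof -
    have "((\<lambda>w. w - a) has_field_derivative 1) (at z)"
      by (auto intro!: derivative_eq_intros)
    from DERIV_power[OF this, of n] show ?thesis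
      by (simp add: Suc)
  qed
  then have "((\<lambda>w. inverse ((w - a) ^ n)) has_field_derivative
      - (inverse ((z - a) ^ n) * (of_nat n * (z - a) ^ m) * inverse ((z - a) ^ n))) (at z)"
    by (rule DERIV_inverse') (use assms in simp)
  moreover have "inverse ((z - a) ^ n) * (of_nat n * (z - a) ^ m) * inverse ((z - a) ^ n)
      = of_nat n / (z - a) ^ (n + 1)"
    using assms by (simp add: Suc divide_simps)
  ultimately show ?thesis
    by (simp add: inverse_eq_divide)
qed simp

text \<open>This treats a single starting point. On its ball the estimates for the pole depend only
  on the ratio of \<open>z - z0\<close> to \<open>\<zeta> - z0\<close>, which stays within
  \<open>\<delta>\<close> of 1, so the relative radius \<open>\<delta>\<close> need not shrink as
  \<open>\<zeta>\<close> approaches \<open>z0\<close>.\<close>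

lemma pole_perturbation_newton_ball:
  fixes T T' g f :: "complex \<Rightarrow> complex" and g' :: "complex \<Rightarrow> complex \<Rightarrow> complex"
  assumes T: "bounded_linear T" and T': "bounded_linear T'"
    and T'T: "\<And>u. T' (T u) = u" and TT': "\<And>y. T (T' y) = y"
    and n: "n \<ge> 1"
    and der: "\<And>w. 0 < cmod w \<Longrightarrow> cmod w < \<rho> \<Longrightarrow> (g has_derivative g' w) (at w)"
    and small0: "\<And>w. 0 < cmod w \<Longrightarrow> cmod w < \<rho> \<Longrightarrow> cmod (w ^ n * T' (g w)) \<le> 2/5 * \<delta>"
    and small1: "\<And>w v. 0 < cmod w \<Longrightarrow> cmod w < \<rho> \<Longrightarrow>
      cmod (w ^ (n + 1) * T' (g' w v)) \<le> 1/11 * cmod v"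
    and f: "\<And>z. 0 < cmod (z - z0) \<Longrightarrow> cmod (z - z0) < \<rho> \<Longrightarrow>
      f z = T (1 / (z - z0) ^ n) + g (z - z0) + k"
    and \<delta>: "0 < \<delta>" "\<delta> < 1"
    and near1: "\<And>x. cmod (x - 1) \<le> \<delta> \<Longrightarrow> cmod (1 / x ^ (n + 1) - 1) \<le> 1/10"
    and \<zeta>: "\<zeta> \<noteq> z0" "(\<zeta> - z0) ^ n = 1 / T' (\<eta> - k)"
    and in\<rho>: "cmod (\<zeta> - z0) * (1 + \<delta>) < \<rho>"
  obtains x where "x \<in> cball \<zeta> (\<delta> * cmod (\<zeta> - z0))" "f x = \<eta>"
    "\<And>y. y \<in> cball \<zeta> (\<delta> * cmod (\<zeta> - z0)) \<Longrightarrow> f y = \<eta> \<Longrightarrow> y = x"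
    "\<And>j. (harm_newton (\<lambda>z. f z - \<eta>) ^^ j) \<zeta> \<in> cball \<zeta> (\<delta> * cmod (\<zeta> - z0))"
    "\<And>j. harm_jac (\<lambda>z. f z - \<eta>) ((harm_newton (\<lambda>z. f z - \<eta>) ^^ j) \<zeta>) \<noteq> 0"
    "(\<lambda>j. (harm_newton (\<lambda>z. f z - \<eta>) ^^ j) \<zeta>) \<longlonglongrightarrow> x"
proof -
  interpret T: bounded_linear T by fact
  interpret T': bounded_linear T' by fact
  define \<omega> where "\<omega> = \<zeta> - z0"
  define F where "F = (\<lambda>z. f z - \<eta>)"
  \<comment> \<open>The exact inverse of the derivative of the leading part
    \<open>T (1 / (z - z0) ^ n)\<close> at \<open>\<zeta>\<close>.\<close>
  define P where "P = (\<lambda>y. - (\<omega> ^ (n + 1) / of_nat n) * T' y)"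
  define L where "L = (\<lambda>z v. T (- (of_nat n / (z - z0) ^ (n + 1)) * v) + g' (z - z0) v)"
  have \<omega>0: "\<omega> \<noteq> 0"
    using \<zeta> by (simp add: \<omega>_def)
  have n0: "of_nat n \<noteq> (0::complex)"
    using n by simp
  have u: "T' (\<eta> - k) = 1 / \<omega> ^ n"
    using \<zeta> by (simp add: \<omega>_def)
  have ratio: "cmod ((z - z0) / \<omega> - 1) \<le> \<delta>" if "z \<in> cball \<zeta> (\<delta> * cmod \<omega>)" for z
  proof -
    have "(z - z0) / \<omega> - 1 = (z - \<zeta>) / \<omega>"
      using \<omega>0 by (simp add: field_simps \<omega>_def)
    then show ?thesis
      using that \<omega>0 by (simp add: norm_divide dist_norm norm_minus_commute pos_divide_le_eq)
  qed
  have dom: "0 < cmod (z - z0)" "cmod (z - z0) < \<rho>" if "z \<in> cball \<zeta> (\<delta> * cmod \<omega>)" for z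
  proof -
    show "0 < cmod (z - z0)"
      using ratio[OF that] \<delta> by auto
    have "cmod (z - z0) \<le> cmod (z - \<zeta>) + cmod \<omega>"
      using norm_triangle_ineq[of "z - \<zeta>" \<omega>] by (simp add: \<omega>_def)
    also have "\<dots> \<le> cmod \<omega> * (1 + \<delta>)"
      using that by (simp add: dist_norm norm_minus_commute algebra_simps)
    finally show "cmod (z - z0) < \<rho>"
      using in\<rho> by (simp add: \<omega>_def)
  qed
  have derF: "(F has_derivative L z) (at z)" if z: "z \<in> cball \<zeta> (\<delta> * cmod \<omega>)" for z
  proof -
    have z0: "z - z0 \<noteq> 0"
      using dom[OF z] by auto
    have "((\<lambda>w. 1 / (w - z0) ^ n) has_field_derivative - (of_nat n / (z - z0) ^ (n + 1))) (at z)"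
      by (rule has_field_derivative_inverse_power[OF z0])
    then have 1: "((\<lambda>w. T (1 / (w - z0) ^ n)) has_derivative
        (\<lambda>v. T (- (of_nat n / (z - z0) ^ (n + 1)) * v))) (at z)"
      unfolding has_field_derivative_def by (rule T.has_derivative)
    have 2: "((\<lambda>w. g (w - z0)) has_derivative (\<lambda>v. g' (z - z0) v)) (at z)"
    proof -
      have "((\<lambda>w. w - z0) has_derivative (\<lambda>v. v)) (at z)"
        by (auto intro!: derivative_eq_intros)
      then show ?thesis
        using der[OF dom[OF z]] by (rule has_derivative_compose)
    qed
    have "((\<lambda>w. T (1 / (w - z0) ^ n) + g (w - z0) + (k - \<eta>)) has_derivative L z) (at z)"
      unfolding L_def by (auto intro!: derivative_eq_intros 1 2)
    moreover have "open (ball z0 \<rho> - {z0})"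
      by (intro open_Diff) auto
    moreover have "z \<in> ball z0 \<rho> - {z0}"
      using dom[OF z] by (auto simp: dist_norm norm_minus_commute)
    moreover have "T (1 / (w - z0) ^ n) + g (w - z0) + (k - \<eta>) = F w" if "w \<in> ball z0 \<rho> - {z0}" for w
      using f[of w] that by (simp add: F_def dist_norm norm_minus_commute)
    ultimately show ?thesis
      by (rule has_derivative_transform_within_open)
  qed
  have near_id: "cmod (P (L z v) - v) \<le> 1/5 * cmod v"
    if z: "z \<in> cball \<zeta> (\<delta> * cmod \<omega>)" for z v
  proof -
    define w where "w = z - z0"
    define x where "x = w / \<omega>"
    have w: "w \<noteq> 0" "0 < cmod w" "cmod w < \<rho>"
      using dom[OF z] by (auto simp: w_def)
    have x: "cmod (1 / x ^ (n + 1) - 1) \<le> 1/10"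
      unfolding x_def w_def by (rule near1[OF ratio[OF z]])
    have \<omega>x: "\<omega> ^ (n + 1) = 1 / x ^ (n + 1) * w ^ (n + 1)"
      using \<omega>0 w by (simp add: x_def power_divide)
    have "P (L z v) = \<omega> ^ (n + 1) / w ^ (n + 1) * v - \<omega> ^ (n + 1) / of_nat n * T' (g' w v)"
    proof -
      have "P (L z v) = - (\<omega> ^ (n + 1) / of_nat n) * (- (of_nat n / w ^ (n + 1)) * v + T' (g' w v))"
        unfolding P_def L_def T'.add T'T w_def ..
      moreover have "- (a / m) * (- (m / b) * v + y) = a / b * v - a / m * y"
        if "m \<noteq> 0" "b \<noteq> 0" for a b m y :: complex
        using that by (simp add: field_simps)
      ultimately show ?thesis
        using n0 w(1) by (metis power_not_zero)
    qed
    also have "\<omega> ^ (n + 1) / w ^ (n + 1) = 1 / x ^ (n + 1)"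
      by (simp add: x_def power_divide)
    also have "\<omega> ^ (n + 1) / of_nat n * T' (g' w v)
      = 1 / x ^ (n + 1) * (1 / of_nat n) * (w ^ (n + 1) * T' (g' w v))"
      unfolding \<omega>x by simp
    finally have eq: "P (L z v) - v = (1 / x ^ (n + 1) - 1) * v
      - 1 / x ^ (n + 1) * (1 / of_nat n) * (w ^ (n + 1) * T' (g' w v))"
      by (simp add: algebra_simps)
    \<comment> \<open>The allowance 1/5 is spent as 1/10 on the variation of the leading derivative
      over the ball and 11/10 * 1/11 on the derivative of the perturbation.\<close>
    have "cmod (1 / x ^ (n + 1)) \<le> 11/10"
      using x norm_triangle_ineq2[of "1 / x ^ (n + 1)" 1] by simp
    moreover have "cmod (1 / of_nat n) \<le> 1"
      using n by (simp add: norm_divide)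
    ultimately have "cmod (1 / x ^ (n + 1) * (1 / of_nat n)) \<le> 11/10 * 1"
      unfolding norm_mult[of "1 / x ^ (n + 1)"] by (rule mult_mono) simp_all
    then have "cmod (1 / x ^ (n + 1) * (1 / of_nat n) * (w ^ (n + 1) * T' (g' w v)))
        \<le> 11/10 * 1 * (1/11 * cmod v)"
      unfolding norm_mult[of _ "w ^ (n + 1) * T' (g' w v)"]
      by (rule mult_mono) (use small1[OF w(2,3)] in simp_all)
    moreover have "cmod ((1 / x ^ (n + 1) - 1) * v) \<le> 1/10 * cmod v"
      unfolding norm_mult by (rule mult_right_mono[OF x norm_ge_zero])
    ultimately show ?thesis
      unfolding eq by (intro order_trans[OF norm_triangle_ineq4]) simp
  qed
  have \<zeta>in: "\<zeta> \<in> cball \<zeta> (\<delta> * cmod \<omega>)"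
    using \<delta> by simp
  \<comment> \<open>The choice of \<open>\<zeta>\<close> makes the leading term equal to
    \<open>\<eta> - k\<close>, so only \<open>g \<omega>\<close> remains. Of the
    \<open>n + 1\<close> powers of \<open>\<omega>\<close> in \<open>P\<close>,
    \<open>small0\<close> absorbs \<open>n\<close>; the last one makes the residual proportional to
    the radius of the ball.\<close>
  have PF: "P (F \<zeta>) = - (\<omega> / of_nat n) * (\<omega> ^ n * T' (g \<omega>))"
  proof -
    have "F \<zeta> = T (1 / \<omega> ^ n) + g \<omega> - (\<eta> - k)"
      using f[OF dom[OF \<zeta>in]] by (simp add: F_def \<omega>_def)
    then have "T' (F \<zeta>) = T' (g \<omega>)"
      by (simp only: T'.add T'T u T'.diff[of _ "\<eta> - k"] add_diff_cancel_left')
    then show ?thesis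
      by (simp add: P_def)
  qed
  have "cmod (\<omega> ^ n * T' (g \<omega>)) \<le> 2/5 * \<delta>"
    using dom[OF \<zeta>in] unfolding \<omega>_def by (rule small0)
  moreover have "cmod (\<omega> / of_nat n) \<le> cmod \<omega>"
    using n by (simp add: norm_divide divide_le_eq mult_le_cancel_left1)
  ultimately have "cmod (P (F \<zeta>)) \<le> cmod \<omega> * (2/5 * \<delta>)"
    unfolding PF norm_mult[of "- (\<omega> / of_nat n)"] norm_minus_cancel by (intro mult_mono) auto
  then have start: "cmod (P (F \<zeta>)) \<le> 2/5 * (\<delta> * cmod \<omega>)"
    by (simp add: mult_ac)
  have P: "bounded_linear P"
    unfolding P_def by (rule bounded_linear_const_mult[OF T'])
  have P0: "y = 0" if "P y = 0" for y
  proof -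
    have "T' y = 0"
      using that \<omega>0 n0 by (simp add: P_def)
    then show ?thesis
      using TT'[of y] T.zero by simp
  qed
  have "\<delta> * cmod \<omega> > 0"
    using \<delta> \<omega>0 by simp
  from harm_newton_ball[OF P P0 this derF near_id start] obtain x
    where "x \<in> cball \<zeta> (\<delta> * cmod \<omega>)" "F x = 0"
      "\<And>y. y \<in> cball \<zeta> (\<delta> * cmod \<omega>) \<Longrightarrow> F y = 0 \<Longrightarrow> y = x"
      "\<And>j. (harm_newton F ^^ j) \<zeta> \<in> cball \<zeta> (\<delta> * cmod \<omega>)"
      "\<And>j. harm_jac F ((harm_newton F ^^ j) \<zeta>) \<noteq> 0"
      "(\<lambda>j. (harm_newton F ^^ j) \<zeta>) \<longlonglongrightarrow> x"
    by blast
  then show ?thesis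
    unfolding F_def \<omega>_def right_minus_eq by (rule that[of x])
qed

text \<open>The constants are chosen in the order \<open>\<delta>\<close> (from \<open>n\<close>
  alone), \<open>\<epsilon>\<close>, \<open>\<rho>\<close> (from the two limits), \<open>R\<close>;
  none depends on \<open>\<eta>\<close>. The scalar \<open>D w\<close> dominates the operator norm
  of \<open>g' w\<close>, so one limit controls all directions \<open>v\<close>.\<close>

lemma pole_perturbation_newton:
  fixes T T' g f :: "complex \<Rightarrow> complex" and g' :: "complex \<Rightarrow> complex \<Rightarrow> complex"
    and D :: "complex \<Rightarrow> real"
  assumes T: "bounded_linear T" and T': "bounded_linear T'"
    and T'T: "\<And>u. T' (T u) = u" and TT': "\<And>y. T (T' y) = y"
    and n: "n \<ge> 1" and r: "r > 0"
    and der: "\<And>w. 0 < cmod w \<Longrightarrow> cmod w < r \<Longrightarrow> (g has_derivative g' w) (at w)"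
    and bound: "\<And>w v. 0 < cmod w \<Longrightarrow> cmod w < r \<Longrightarrow> cmod (g' w v) \<le> D w * cmod v"
    and lim0: "((\<lambda>w. w ^ n * g w) \<longlongrightarrow> 0) (at 0)"
    and lim1: "((\<lambda>w. cmod w ^ (n + 1) * D w) \<longlongrightarrow> 0) (at 0)"
    and f: "\<And>z. 0 < cmod (z - z0) \<Longrightarrow> cmod (z - z0) < r \<Longrightarrow>
      f z = T (1 / (z - z0) ^ n) + g (z - z0) + k"
  shows "\<exists>\<rho>>0. \<rho> \<le> r \<and> (\<exists>R. \<forall>\<eta>::complex.
           let c = \<eta> - k;
               q = 1 / T' c;
               S = {\<zeta>. (\<zeta> - z0) ^ n = q};
               F = (\<lambda>z. f z - \<eta>);
               Sol = {z. 0 < cmod (z - z0) \<and> cmod (z - z0) < \<rho> \<and> f z = \<eta>}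
           in R < cmod c \<longrightarrow>
              card Sol = n \<and>
              (\<forall>\<zeta>\<in>S. (\<forall>k. 0 < cmod ((harm_newton F ^^ k) \<zeta> - z0)
                             \<and> cmod ((harm_newton F ^^ k) \<zeta> - z0) < r
                             \<and> harm_jac F ((harm_newton F ^^ k) \<zeta>) \<noteq> 0)
                       \<and> convergent (\<lambda>k. (harm_newton F ^^ k) \<zeta>)) \<and>
              bij_betw (harm_newton_lim F) S Sol)"
proof -
  interpret T: bounded_linear T by fact
  interpret T': bounded_linear T' by fact
  obtain B where B: "B > 0" "\<And>y. cmod (T' y) \<le> cmod y * B"
    using T'.pos_bounded by blast
  obtain C where C: "C > 0" "\<And>u. cmod (T u) \<le> cmod u * C"
    using T.pos_bounded by blast

  have "isCont (\<lambda>x::complex. 1 / x ^ (n + 1) - 1) 1"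
    by (intro continuous_intros) auto
  then obtain d1 where d1: "d1 > 0"
    "\<And>x::complex. dist x 1 < d1 \<Longrightarrow> dist (1 / x ^ (n + 1) - 1) (1 / 1 ^ (n + 1) - 1) < 1/10"
    unfolding continuous_at_eps_delta by (meson zero_less_divide_1_iff zero_less_numeral)
  have "finite {\<xi>::complex. \<xi> ^ n = 1}"
    using n by (intro finite_roots_unity) auto
  from finite_set_avoid[OF this, of 1] obtain d2 where d2: "d2 > 0"
    "\<And>\<xi>::complex. \<xi> ^ n = 1 \<Longrightarrow> \<xi> \<noteq> 1 \<Longrightarrow> d2 \<le> dist 1 \<xi>"
    by blast
  \<comment> \<open>\<open>d1 / 2\<close> secures the bound 1/10 on ratios, \<open>d2 / 3\<close>
    keeps \<open>2 * \<delta>\<close> below the distance from 1 to every other root of unity, and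
    1/2 keeps the balls away from \<open>z0\<close>.\<close>
  define \<delta> where "\<delta> = Min {d1 / 2, d2 / 3, 1/2}"
  have \<delta>: "0 < \<delta>" "\<delta> < 1" "\<delta> < d1" "2 * \<delta> < d2"
    using d1 d2 by (auto simp: \<delta>_def min_def)
  have near1: "cmod (1 / x ^ (n + 1) - 1) \<le> 1/10" if "cmod (x - 1) \<le> \<delta>" for x
    using d1(2)[of x] that \<delta> by (simp add: dist_norm)
  have sep: "\<xi> = 1" if "\<xi> ^ n = 1" "cmod (\<xi> - 1) \<le> 2 * \<delta>" for \<xi>
    using d2(2)[of \<xi>] that \<delta> by (force simp: dist_norm norm_minus_commute)
  obtain \<epsilon>1 where \<epsilon>1: "\<epsilon>1 > 0"
    "\<And>x::complex. cmod (x ^ n - 1) \<le> \<epsilon>1 \<Longrightarrow> \<exists>\<xi>. \<xi> ^ n = 1 \<and> cmod (x - \<xi>) \<le> \<delta>"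
    using near_root_of_unity[OF n \<delta>(1)] by blast
  \<comment> \<open>\<open>\<epsilon>1\<close> locates arbitrary solutions near starting points,
    \<open>2/5 * \<delta>\<close> bounds the initial residual, and 1/11 bounds the derivative of the
    perturbation. Below, the target is \<open>\<epsilon> / B\<close> because applying
    \<open>T'\<close> costs a factor \<open>B\<close>.\<close>
  define \<epsilon> where "\<epsilon> = Min {\<epsilon>1, 2/5 * \<delta>, 1/11}"
  have \<epsilon>: "0 < \<epsilon>" "\<epsilon> \<le> \<epsilon>1" "\<epsilon> \<le> 2/5 * \<delta>" "\<epsilon> \<le> 1/11"
    using \<epsilon>1 \<delta> by (auto simp: \<epsilon>_def)
  have "\<epsilon> / B > 0"
    using \<epsilon> B by simp
  then have "\<forall>\<^sub>F w in at 0. cmod (w ^ n * g w) < \<epsilon> / B \<and> cmod w ^ (n + 1) * D w < \<epsilon> / B"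
    using tendstoD[OF lim0] order_tendstoD(2)[OF lim1]
    by (intro eventually_conj) (auto simp: dist_norm)
  then obtain d where d: "d > 0"
    "\<And>w. w \<noteq> 0 \<Longrightarrow> cmod w < d \<Longrightarrow> cmod (w ^ n * g w) < \<epsilon> / B \<and> cmod w ^ (n + 1) * D w < \<epsilon> / B"
    unfolding eventually_at by (auto simp: dist_norm)
  define \<rho> where "\<rho> = min d r"
  have \<rho>: "\<rho> > 0" "\<rho> \<le> r" "\<rho> \<le> d"
    using d r by (auto simp: \<rho>_def)
  have small0: "cmod (w ^ n * T' (g w)) \<le> \<epsilon>" if "0 < cmod w" "cmod w < \<rho>" for w
  proof -
    have "cmod (w ^ n * T' (g w)) \<le> cmod (w ^ n) * (cmod (g w) * B)"
      unfolding norm_mult by (intro mult_left_mono B) auto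
    also have "\<dots> = cmod (w ^ n * g w) * B"
      by (simp add: norm_mult)
    also have "\<dots> \<le> \<epsilon>"
      using d(2)[of w] that \<rho> B by (auto simp: pos_less_divide_eq)
    finally show ?thesis .
  qed
  have small1: "cmod (w ^ (n + 1) * T' (g' w v)) \<le> \<epsilon> * cmod v"
    if w: "0 < cmod w" "cmod w < \<rho>" for w v
  proof -
    have "cmod (w ^ (n + 1) * T' (g' w v)) \<le> cmod w ^ (n + 1) * (D w * cmod v * B)"
      unfolding norm_mult norm_power
      using order_trans[OF B(2) mult_right_mono[OF bound]] w \<rho> B
      by (intro mult_left_mono) auto
    also have "\<dots> = (cmod w ^ (n + 1) * D w) * B * cmod v"
      by (simp add: mult_ac)
    also have "\<dots> \<le> \<epsilon> * cmod v"
      using d(2)[of w] that \<rho> B by (intro mult_right_mono) (auto simp: pos_less_divide_eq)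
    finally show ?thesis .
  qed
  \<comment> \<open>With \<open>u = T' (\<eta> - k)\<close>, the bound
    \<open>cmod (T u) \<le> cmod u * C\<close> shows that \<open>cmod (\<eta> - k) > R\<close>
    forces \<open>1 / cmod u < (\<rho> / 2) ^ n\<close>. The common distance \<open>s\<close> of the
    starting points from \<open>z0\<close> is then below \<open>\<rho> / 2\<close>, and
    \<open>s * (1 + \<delta>) < \<rho>\<close>.\<close>
  define R where "R = C / (\<rho> / 2) ^ n"
  have R: "R \<ge> 0"
    using C \<rho> by (simp add: R_def)
  have key: "card Sol = n \<and>
              (\<forall>\<zeta>\<in>S. (\<forall>k. 0 < cmod ((harm_newton F ^^ k) \<zeta> - z0)
                             \<and> cmod ((harm_newton F ^^ k) \<zeta> - z0) < r
                             \<and> harm_jac F ((harm_newton F ^^ k) \<zeta>) \<noteq> 0)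
                       \<and> convergent (\<lambda>k. (harm_newton F ^^ k) \<zeta>)) \<and>
              bij_betw (harm_newton_lim F) S Sol"
    if S: "S = {\<zeta>. (\<zeta> - z0) ^ n = 1 / T' (\<eta> - k)}" and F: "F = (\<lambda>z. f z - \<eta>)"
      and Sol: "Sol = {z. 0 < cmod (z - z0) \<and> cmod (z - z0) < \<rho> \<and> f z = \<eta>}"
      and c: "R < cmod (\<eta> - k)" for \<eta> S F Sol
  proof -
    define u where "u = T' (\<eta> - k)"
    have Tu: "T u = \<eta> - k"
      by (simp add: u_def TT')
    have u0: "u \<noteq> 0"
      using Tu c R T.zero by auto
    have S': "\<zeta> \<in> S \<longleftrightarrow> (\<zeta> - z0) ^ n = 1 / u" for \<zeta>
      by (simp add: S u_def)
    have uR: "R < cmod u * C"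
      using c C(2)[of u] Tu by simp
    have "card S = card {w. w ^ n = 1 / u}"
      by (rule bij_betw_same_card[of "\<lambda>\<zeta>. \<zeta> - z0"],
          rule bij_betwI[where g = "\<lambda>w. w + z0"]) (auto simp: S')
    also have "\<dots> = n"
      using card_nth_roots[of "1 / u" n] u0 n by simp
    finally have cardS: "card S = n" .
    define s where "s = root n (1 / cmod u)"
    have Snorm: "cmod (\<zeta> - z0) = s" if "\<zeta> \<in> S" for \<zeta>
    proof -
      have "cmod (\<zeta> - z0) ^ n = 1 / cmod u"
        using that by (simp add: S' flip: norm_power) (simp add: norm_divide)
      then show ?thesis
        using n real_root_power_cancel[of n "cmod (\<zeta> - z0)"] by (simp add: s_def)
    qed
    have s0: "s > 0"
      using u0 n by (simp add: s_def)
    have "s < root n ((\<rho> / 2) ^ n)"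
      unfolding s_def using n uR u0 C \<rho>
      by (intro real_root_less_mono) (auto simp: R_def field_simps)
    then have s\<rho>: "s < \<rho> / 2"
      using n \<rho> by (simp add: real_root_power_cancel)
    have s\<rho>': "s * (1 + \<delta>) < \<rho>"
    proof -
      have "s * (1 + \<delta>) \<le> s * 2"
        using s0 \<delta> by (intro mult_left_mono) auto
      then show ?thesis
        using s\<rho> by simp
    qed
    have ex: "\<exists>x. x \<in> cball \<zeta> (\<delta> * s) \<and> f x = \<eta> \<and> (\<forall>y. y \<in> cball \<zeta> (\<delta> * s) \<longrightarrow> f y = \<eta> \<longrightarrow> y = x)
      \<and> (\<forall>j. (harm_newton F ^^ j) \<zeta> \<in> cball \<zeta> (\<delta> * s))
      \<and> (\<forall>j. harm_jac F ((harm_newton F ^^ j) \<zeta>) \<noteq> 0)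
      \<and> (\<lambda>j. (harm_newton F ^^ j) \<zeta>) \<longlonglongrightarrow> x" if \<zeta>: "\<zeta> \<in> S" for \<zeta>
    proof -
      have neq: "\<zeta> \<noteq> z0"
        using Snorm[OF \<zeta>] s0 by auto
      have eq: "(\<zeta> - z0) ^ n = 1 / T' (\<eta> - k)"
        using \<zeta> by (simp add: S)
      have le: "cmod (\<zeta> - z0) * (1 + \<delta>) < \<rho>"
        using s\<rho>' Snorm[OF \<zeta>] by simp
      have 0: "cmod (w ^ n * T' (g w)) \<le> 2/5 * \<delta>" if "0 < cmod w" "cmod w < \<rho>" for w
        using small0[OF that] \<epsilon> by simp
      have 1: "cmod (w ^ (n + 1) * T' (g' w v)) \<le> 1/11 * cmod v"
        if "0 < cmod w" "cmod w < \<rho>" for w v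
        using small1[OF that, of v] mult_right_mono[OF \<epsilon>(4) norm_ge_zero[of v]] by linarith
      have dr: "(g has_derivative g' w) (at w)" if "0 < cmod w" "cmod w < \<rho>" for w
        using der that \<rho> by simp
      have ff: "f z = T (1 / (z - z0) ^ n) + g (z - z0) + k"
        if "0 < cmod (z - z0)" "cmod (z - z0) < \<rho>" for z
        using f that \<rho> by simp
      show ?thesis
      proof (rule pole_perturbation_newton_ball[OF T T' T'T TT' n dr 0 1 ff \<delta>(1,2) near1 neq eq le,
            unfolded Snorm[OF \<zeta>], folded F])
        fix x
        assume "x \<in> cball \<zeta> (\<delta> * s)" "f x = \<eta>"
          "\<And>y. y \<in> cball \<zeta> (\<delta> * s) \<Longrightarrow> f y = \<eta> \<Longrightarrow> y = x"
          "\<And>j. (harm_newton F ^^ j) \<zeta> \<in> cball \<zeta> (\<delta> * s)"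
          "\<And>j. harm_jac F ((harm_newton F ^^ j) \<zeta>) \<noteq> 0"
          "(\<lambda>j. (harm_newton F ^^ j) \<zeta>) \<longlonglongrightarrow> x"
        then show ?thesis
          by (intro exI[of _ x] conjI allI impI)
      qed
    qed
    \<comment> \<open>It remains to show that this selection, which agrees with
      \<open>harm_newton_lim F\<close> on \<open>S\<close>, is a bijection onto
      \<open>Sol\<close>.\<close>
    obtain X where "\<forall>\<zeta>\<in>S. X \<zeta> \<in> cball \<zeta> (\<delta> * s) \<and> f (X \<zeta>) = \<eta>
      \<and> (\<forall>y. y \<in> cball \<zeta> (\<delta> * s) \<longrightarrow> f y = \<eta> \<longrightarrow> y = X \<zeta>)
      \<and> (\<forall>j. (harm_newton F ^^ j) \<zeta> \<in> cball \<zeta> (\<delta> * s))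
      \<and> (\<forall>j. harm_jac F ((harm_newton F ^^ j) \<zeta>) \<noteq> 0)
      \<and> (\<lambda>j. (harm_newton F ^^ j) \<zeta>) \<longlonglongrightarrow> X \<zeta>"
      using bchoice[OF ballI[OF ex, of S "\<lambda>\<zeta>. \<zeta>"]] by blast
    then have X: "\<And>\<zeta>. \<zeta> \<in> S \<Longrightarrow> X \<zeta> \<in> cball \<zeta> (\<delta> * s)" "\<And>\<zeta>. \<zeta> \<in> S \<Longrightarrow> f (X \<zeta>) = \<eta>"
      "\<And>\<zeta> y. \<zeta> \<in> S \<Longrightarrow> y \<in> cball \<zeta> (\<delta> * s) \<Longrightarrow> f y = \<eta> \<Longrightarrow> y = X \<zeta>"
      "\<And>\<zeta> j. \<zeta> \<in> S \<Longrightarrow> (harm_newton F ^^ j) \<zeta> \<in> cball \<zeta> (\<delta> * s)"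
      "\<And>\<zeta> j. \<zeta> \<in> S \<Longrightarrow> harm_jac F ((harm_newton F ^^ j) \<zeta>) \<noteq> 0"
      "\<And>\<zeta>. \<zeta> \<in> S \<Longrightarrow> (\<lambda>j. (harm_newton F ^^ j) \<zeta>) \<longlonglongrightarrow> X \<zeta>"
      by blast+
    have ball: "0 < cmod (z - z0) \<and> cmod (z - z0) < \<rho>" if "\<zeta> \<in> S" "z \<in> cball \<zeta> (\<delta> * s)" for \<zeta> z
    proof -
      have "cmod (z - \<zeta>) \<le> \<delta> * s"
        using that by (simp add: dist_norm norm_minus_commute)
      moreover have "\<delta> * s < s"
        using \<delta> s0 by simp
      moreover have "cmod (\<zeta> - z0) \<le> cmod (z - z0) + cmod (z - \<zeta>)"
        using norm_triangle_ineq4[of "z - z0" "z - \<zeta>"] by simp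
      moreover have "cmod (z - z0) \<le> cmod (z - \<zeta>) + cmod (\<zeta> - z0)"
        using norm_triangle_ineq[of "z - \<zeta>" "\<zeta> - z0"] by simp
      ultimately show ?thesis
        using Snorm[OF that(1)] s\<rho>' by (auto simp: algebra_simps)
    qed
    have lim: "harm_newton_lim F \<zeta> = X \<zeta>" if "\<zeta> \<in> S" for \<zeta>
      unfolding harm_newton_lim_def using X(6)[OF that] by (rule limI)
    \<comment> \<open>The quotient of two starting points is a root of unity. A shared zero would
      put it within \<open>2 * \<delta>\<close> of 1, where \<open>sep\<close> leaves only 1
      itself.\<close>
    have inj: "inj_on X S"
    proof (rule inj_onI)
      fix \<zeta> \<zeta>' assume \<zeta>: "\<zeta> \<in> S" "\<zeta>' \<in> S" "X \<zeta> = X \<zeta>'"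
      define \<xi> where "\<xi> = (\<zeta>' - z0) / (\<zeta> - z0)"
      have nz: "\<zeta> - z0 \<noteq> 0"
        using Snorm[OF \<zeta>(1)] s0 by auto
      have "dist \<zeta> \<zeta>' \<le> 2 * \<delta> * s"
        using X(1)[OF \<zeta>(1)] X(1)[OF \<zeta>(2)] \<zeta>(3) dist_triangle2[of \<zeta> \<zeta>' "X \<zeta>"] by simp
      moreover have "\<xi> - 1 = (\<zeta>' - \<zeta>) / (\<zeta> - z0)"
        using nz by (simp add: \<xi>_def field_simps)
      ultimately have "cmod (\<xi> - 1) \<le> 2 * \<delta>"
        using s0 Snorm[OF \<zeta>(1)]
        by (simp add: norm_divide dist_norm norm_minus_commute pos_divide_le_eq)
      moreover have "\<xi> ^ n = 1"
        using \<zeta> u0 by (simp add: \<xi>_def power_divide S')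
      ultimately have "\<xi> = 1"
        using sep by blast
      then show "\<zeta> = \<zeta>'"
        using nz by (simp add: \<xi>_def)
    qed
    have "X ` S = Sol"
    proof
      show "X ` S \<subseteq> Sol"
        using ball X(1,2) by (auto simp: Sol)
      \<comment> \<open>Applying \<open>T'\<close> to the equation gives
        \<open>u = 1 / w ^ n + T' (g w)\<close>, so \<open>w ^ n * u\<close> is close to 1. Relative
        to one starting point with offset \<open>\<omega>\<close>, where
        \<open>\<omega> ^ n = 1 / u\<close>, this places \<open>w / \<omega>\<close> near a root of
        unity \<open>\<xi>\<close>. Hence \<open>z\<close> lies in the ball about the starting point
        \<open>z0 + \<omega> * \<xi>\<close>, and uniqueness there identifies it.\<close>
      show "Sol \<subseteq> X ` S"
      proof
        fix z assume "z \<in> Sol"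
        then have z: "0 < cmod (z - z0)" "cmod (z - z0) < \<rho>" "f z = \<eta>"
          by (auto simp: Sol)
        define w where "w = z - z0"
        have w0: "w \<noteq> 0"
          using z by (auto simp: w_def)
        have "\<eta> - k = T (1 / w ^ n) + g w"
          using f[of z] z \<rho> by (simp add: w_def)
        then have "u = 1 / w ^ n + T' (g w)"
          by (simp add: u_def T'.add T'T)
        then have "w ^ n * u - 1 = w ^ n * T' (g w)"
          using w0 by (simp add: field_simps)
        then have un: "cmod (w ^ n * u - 1) \<le> \<epsilon>1"
          using small0[of w] z \<epsilon> by (simp add: w_def)
        obtain \<zeta>0 where \<zeta>0: "\<zeta>0 \<in> S"
          using cardS n by (metis card.empty ex_in_conv not_one_le_zero)
        define \<omega> where "\<omega> = \<zeta>0 - z0"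
        have \<omega>: "\<omega> \<noteq> 0" "\<omega> ^ n = 1 / u" "cmod \<omega> = s"
          using \<zeta>0 Snorm[OF \<zeta>0] s0 by (auto simp: \<omega>_def S')
        have "(w / \<omega>) ^ n = w ^ n * u"
          by (simp add: power_divide \<omega>(2))
        then obtain \<xi> where \<xi>: "\<xi> ^ n = 1" "cmod (w / \<omega> - \<xi>) \<le> \<delta>"
          using \<epsilon>1(2)[of "w / \<omega>"] un by auto
        have in_S: "z0 + \<omega> * \<xi> \<in> S"
          by (simp add: S' power_mult_distrib \<omega>(2) \<xi>)
        have "z - (z0 + \<omega> * \<xi>) = (w / \<omega> - \<xi>) * \<omega>"
          using \<omega> by (simp add: w_def field_simps)
        then have "cmod (z - (z0 + \<omega> * \<xi>)) \<le> \<delta> * s"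
          using \<xi>(2) \<omega>(3) s0 by (metis norm_mult mult_right_mono less_imp_le)
        then have "z \<in> cball (z0 + \<omega> * \<xi>) (\<delta> * s)"
          by (simp add: dist_norm norm_minus_commute)
        then show "z \<in> X ` S"
          using X(3)[OF in_S _ z(3)] in_S by blast
      qed
    qed
    with inj have bij: "bij_betw X S Sol"
      by (simp add: bij_betw_def)
    then have "card Sol = n"
      using bij_betw_same_card cardS by fastforce
    moreover have "bij_betw (harm_newton_lim F) S Sol"
      using bij bij_betw_cong[of S "harm_newton_lim F" X] lim by simp
    moreover have "\<forall>\<zeta>\<in>S. (\<forall>k. 0 < cmod ((harm_newton F ^^ k) \<zeta> - z0)
                             \<and> cmod ((harm_newton F ^^ k) \<zeta> - z0) < r
                             \<and> harm_jac F ((harm_newton F ^^ k) \<zeta>) \<noteq> 0)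
                       \<and> convergent (\<lambda>k. (harm_newton F ^^ k) \<zeta>)"
      using X(4,5,6) ball \<rho> by (meson convergentI order_less_le_trans)
    ultimately show ?thesis
      by (intro conjI)
  qed
  show ?thesis
    unfolding Let_def
    by (rule exI[of _ \<rho>], rule conjI[OF \<rho>(1)], rule conjI[OF \<rho>(2)], rule exI[of _ R],
        intro allI impI, rule key[OF refl refl refl])
qed

section \<open>Asymptotics of the perturbation: Laurent tails and the logarithm\<close>

text \<open>The tail is \<open>(h w - c 0) / w ^ n\<close> with \<open>h\<close> a genuine power
  series. Hence \<open>w ^ n * p w = h w - c 0\<close> and
  \<open>w ^ (n + 1) * p' w = w * h' w - n * (h w - c 0)\<close>, and both vanish at 0 by continuity
  of \<open>h\<close> and \<open>h'\<close>.\<close>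

lemma pole_tail_asymptotics:
  fixes c :: "nat \<Rightarrow> complex" and r :: real
  assumes r: "r > 0"
    and conv: "\<And>w. 0 < cmod w \<Longrightarrow> cmod w < r \<Longrightarrow> summable (\<lambda>m. c m * w ^ m)"
  obtains p p' where
    "\<And>w. 0 < cmod w \<Longrightarrow> cmod w < r \<Longrightarrow> (\<Sum>m. c m * w ^ m) / w ^ n = c 0 / w ^ n + p w"
    "\<And>w. 0 < cmod w \<Longrightarrow> cmod w < r \<Longrightarrow> (p has_field_derivative p' w) (at w)"
    "((\<lambda>w. w ^ n * p w) \<longlongrightarrow> 0) (at 0)"
    "((\<lambda>w. w ^ (n + 1) * p' w) \<longlongrightarrow> 0) (at 0)"
proof -
  define h where "h = (\<lambda>w. \<Sum>m. c m * w ^ m)"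
  define h' where "h' = (\<lambda>w. \<Sum>m. diffs c m * w ^ m)"
  define p where "p = (\<lambda>w. (h w - c 0) / w ^ n)"
  define p' where "p' = (\<lambda>w. h' w / w ^ n - of_nat n * (h w - c 0) / w ^ (n + 1))"
  \<comment> \<open>The hypothesis, coming from a Laurent series, says nothing at the centre; there
    the power series converges trivially.\<close>
  have conv': "summable (\<lambda>m. c m * w ^ m)" if "cmod w < r" for w
  proof (cases "w = 0")
    case True
    then show ?thesis
      using powser_sums_zero[of c] by (simp add: sums_iff)
  next
    case False
    then show ?thesis
      using conv[of w] that by simp
  qed
  \<comment> \<open>Termwise differentiation is available only strictly inside a point of
    convergence.\<close>
  have larger: "\<exists>K::complex. cmod w < cmod K \<and> cmod K < r" if wr: "cmod w < r" for w
  proof -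
    obtain t where "cmod w < t" "t < r"
      using dense[OF wr] by blast
    moreover have "t \<ge> 0"
      using calculation norm_ge_zero[of w] by linarith
    ultimately show ?thesis
      by (intro exI[of _ "of_real t"]) simp
  qed
  have dh: "(h has_field_derivative h' w) (at w)" if wr: "cmod w < r" for w
  proof -
    obtain K :: complex where "cmod w < cmod K" "cmod K < r"
      using larger[OF wr] by blast
    then show ?thesis
      unfolding h_def h'_def by (intro termdiffs_strong conv')
  qed
  have "isCont h' 0"
  proof -
    obtain K :: complex where "cmod 0 < cmod K" "cmod K < r"
      using larger[of 0] r by auto
    then show ?thesis
      unfolding h'_def by (intro isCont_powser termdiff_converges[of _ r] conv')
  qed
  then have h'0: "(h' \<longlongrightarrow> h' 0) (at 0)"
    by (simp add: isCont_def)
  have "isCont h 0"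
    using dh[of 0] r DERIV_isCont by auto
  moreover have "h 0 = c 0"
    by (simp add: h_def powser_zero)
  ultimately have h0: "((\<lambda>w. h w - c 0) \<longlongrightarrow> 0) (at 0)"
    by (simp add: isCont_def LIM_zero_iff)
  show ?thesis
  proof (rule that[of p p'])
    fix w assume w: "0 < cmod w" "cmod w < r"
    show "(\<Sum>m. c m * w ^ m) / w ^ n = c 0 / w ^ n + p w"
      by (simp add: p_def h_def diff_divide_distrib)
    have "((\<lambda>w. h w - c 0) has_field_derivative h' w) (at w)"
      using dh[OF w(2)] by (auto intro!: derivative_eq_intros)
    from DERIV_mult[OF this has_field_derivative_inverse_power[of w 0 n]] w
    show "(p has_field_derivative p' w) (at w)"
      unfolding p_def p'_def by (simp add: algebra_simps)
  next
    have "\<forall>\<^sub>F w in at 0. h w - c 0 = w ^ n * p w"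
      by (rule eventually_at_filter[THEN iffD2]) (auto simp: p_def)
    then show "((\<lambda>w. w ^ n * p w) \<longlongrightarrow> 0) (at 0)"
      using h0 by (rule Lim_transform_eventually[rotated])
    have "((\<lambda>w. w * h' w - of_nat n * (h w - c 0)) \<longlongrightarrow> 0 * h' 0 - of_nat n * 0) (at 0)"
      by (intro tendsto_intros h'0 h0)
    moreover have "w * h' w - of_nat n * (h w - c 0) = w ^ (n + 1) * p' w" if "w \<noteq> 0" for w
      using that by (simp add: p'_def field_simps)
    then have "\<forall>\<^sub>F w in at 0. w * h' w - of_nat n * (h w - c 0) = w ^ (n + 1) * p' w"
      by (simp add: eventually_at_filter)
    ultimately show "((\<lambda>w. w ^ (n + 1) * p' w) \<longlongrightarrow> 0) (at 0)"
      by (simp add: Lim_transform_eventually)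
  qed
qed

text \<open>The derivative is the real part of \<open>v / w\<close>, written as an inner product so
  that Cauchy-Schwarz bounds it.\<close>

lemma
  fixes w :: complex
  assumes "w \<noteq> 0"
  shows has_derivative_ln_norm:
      "((\<lambda>w. ln (cmod w)) has_derivative (\<lambda>v. inner v (sgn w) / cmod w)) (at w)"
    and ln_norm_derivative_bound: "\<bar>inner v (sgn w) / cmod w\<bar> \<le> cmod v / cmod w"
proof -
  show "((\<lambda>w. ln (cmod w)) has_derivative (\<lambda>v. inner v (sgn w) / cmod w)) (at w)"
    using assms by (auto intro!: derivative_eq_intros has_derivative_norm simp: field_simps)
  have "\<bar>inner v (sgn w)\<bar> \<le> cmod v"
    using Cauchy_Schwarz_ineq2[of v "sgn w"] assms by (simp add: norm_sgn)
  then show "\<bar>inner v (sgn w) / cmod w\<bar> \<le> cmod v / cmod w"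
    by (simp add: divide_right_mono)
qed

text \<open>One factor \<open>cmod w\<close> already beats the logarithm, by the substitution of
  \<open>inverse x\<close> in \<open>ln x / x\<close>; the other \<open>n - 1\<close> factors have a
  finite limit.\<close>

lemma power_mult_ln_norm_tendsto_0:
  assumes "n \<ge> 1"
  shows "((\<lambda>w::complex. w ^ n * of_real (ln (cmod w))) \<longlongrightarrow> 0) (at 0)"
proof -
  have "((\<lambda>x::real. x * ln x) \<longlongrightarrow> 0) (at_right 0)"
  proof (rule Lim_transform_eventually)
    show "((\<lambda>x::real. - (ln (inverse x) / inverse x)) \<longlongrightarrow> 0) (at_right 0)"
      using filterlim_compose[OF ln_x_over_x_tendsto_0 filterlim_inverse_at_top_right]
      by (auto intro: tendsto_minus[of _ 0, simplified])
    show "\<forall>\<^sub>F x::real in at_right 0. - (ln (inverse x) / inverse x) = x * ln x"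
      by (rule eventually_at_right_less[THEN eventually_mono]) (simp add: ln_inverse divide_inverse)
  qed
  moreover have "filterlim (cmod :: complex \<Rightarrow> real) (at_right 0) (at 0)"
    by (auto simp: filterlim_at eventually_at_filter intro!: tendsto_eq_intros)
  ultimately have "((\<lambda>w::complex. cmod w * ln (cmod w)) \<longlongrightarrow> 0) (at 0)"
    by (rule filterlim_compose)
  then have "((\<lambda>w::complex. cmod w ^ (n - 1) * (cmod w * ln (cmod w))) \<longlongrightarrow> 0 ^ (n - 1) * 0) (at 0)"
    by (intro tendsto_mult) (auto intro!: tendsto_eq_intros)
  moreover have "cmod w ^ (n - 1) * (cmod w * ln (cmod w)) = cmod w ^ n * ln (cmod w)" for w :: complex
    using assms by (simp add: power_eq_if)
  ultimately have "((\<lambda>w::complex. cmod w ^ n * ln (cmod w)) \<longlongrightarrow> 0) (at 0)"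
    by (simp only: mult_zero_right)
  then have "((\<lambda>w::complex. \<bar>cmod w ^ n * ln (cmod w)\<bar>) \<longlongrightarrow> 0) (at 0)"
    by (rule tendsto_rabs_zero)
  moreover have "\<bar>cmod w ^ n * ln (cmod w)\<bar> = cmod (w ^ n * of_real (ln (cmod w)))" for w :: complex
    by (simp only: norm_mult norm_power norm_of_real abs_mult power_abs abs_norm_cancel)
  ultimately show ?thesis
    by (subst tendsto_norm_zero_iff[symmetric]) (simp only:)
qed

text \<open>Since \<open>\<rho>\<close> precedes \<open>\<eta>\<close>, "near \<open>z0\<close>"
  means one fixed punctured disc. As \<open>harm_newton\<close> and \<open>lim\<close> are total,
  the clauses on the iterates and on convergence ensure that both are used only where they are
  meaningful.\<close>

theorem theorem3p2:
  fixes z0 :: complex and r :: real and n :: nat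
    and a b :: "int \<Rightarrow> complex" and A :: complex
    and f :: "complex \<Rightarrow> complex"
  assumes r_pos: "r > 0"
    and n_ge: "n \<ge> 1"
    and conv_a: "\<And>z. 0 < cmod (z - z0) \<Longrightarrow> cmod (z - z0) < r \<Longrightarrow>
                   summable (\<lambda>m. a (int m - int n) * (z - z0) powi (int m - int n))"
    and conv_b: "\<And>z. 0 < cmod (z - z0) \<Longrightarrow> cmod (z - z0) < r \<Longrightarrow>
                   summable (\<lambda>m. b (int m - int n) * (z - z0) powi (int m - int n))"
    and f_eq: "\<And>z. 0 < cmod (z - z0) \<Longrightarrow> cmod (z - z0) < r \<Longrightarrow>
                 f z = (\<Sum>m. a (int m - int n) * (z - z0) powi (int m - int n))
                     + cnj (\<Sum>m. b (int m - int n) * (z - z0) powi (int m - int n))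
                     + 2 * A * complex_of_real (ln (cmod (z - z0)))"
    and ab: "cmod (a (- int n)) \<noteq> cmod (b (- int n))"
  shows "\<exists>\<rho>>0. \<rho> \<le> r \<and> (\<exists>R. \<forall>\<eta>::complex.
           let c = \<eta> - (a 0 + cnj (b 0));
               q = complex_of_real ((cmod (a (- int n)))\<^sup>2 - (cmod (b (- int n)))\<^sup>2)
                   / (cnj (a (- int n)) * c - cnj (b (- int n)) * cnj c);
               S = {\<zeta>. (\<zeta> - z0) ^ n = q};
               F = (\<lambda>z. f z - \<eta>);
               Sol = {z. 0 < cmod (z - z0) \<and> cmod (z - z0) < \<rho> \<and> f z = \<eta>}
           in R < cmod c \<longrightarrow>
              card Sol = n \<and>
              (\<forall>\<zeta>\<in>S. (\<forall>k. 0 < cmod ((harm_newton F ^^ k) \<zeta> - z0)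
                             \<and> cmod ((harm_newton F ^^ k) \<zeta> - z0) < r
                             \<and> harm_jac F ((harm_newton F ^^ k) \<zeta>) \<noteq> 0)
                       \<and> convergent (\<lambda>k. (harm_newton F ^^ k) \<zeta>)) \<and>
              bij_betw (harm_newton_lim F) S Sol)"
proof -
  define \<alpha> where "\<alpha> = a (- int n)"
  define \<beta> where "\<beta> = b (- int n)"
  define J where "J = complex_of_real ((cmod \<alpha>)\<^sup>2 - (cmod \<beta>)\<^sup>2)"
  define T where "T = (\<lambda>u. \<alpha> * u + cnj \<beta> * cnj u)"
  \<comment> \<open>The inverse of \<open>T\<close> by Cramer's rule, with determinant
    \<open>J\<close> nonzero by \<open>ab\<close>. It also turns the equation for the starting
    points into \<open>(\<zeta> - z0) ^ n = 1 / T' c\<close>, as \<open>inv\<close> records.\<close>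
  define T' where "T' = (\<lambda>y. (cnj \<alpha> * y - cnj \<beta> * cnj y) / J)"
  define k where "k = a 0 + cnj (b 0)"
  have J0: "J \<noteq> 0"
    using ab by (simp add: J_def \<alpha>_def \<beta>_def del: of_real_power of_real_diff)
  have cnjJ: "cnj J = J"
    by (simp add: J_def)
  have Jeq: "J = \<alpha> * cnj \<alpha> - \<beta> * cnj \<beta>"
    by (simp add: J_def complex_norm_square del: of_real_power)
  have T: "bounded_linear T"
    unfolding T_def
    by (intro bounded_linear_add bounded_linear_const_mult bounded_linear_ident bounded_linear_cnj)
  have T': "bounded_linear T'"
    unfolding T'_def divide_inverse
    by (intro bounded_linear_mult_const bounded_linear_sub bounded_linear_const_mult
        bounded_linear_ident bounded_linear_cnj)
  have T'T: "T' (T u) = u" for u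
    unfolding T_def T'_def nonzero_divide_eq_eq[OF J0] by (simp add: Jeq algebra_simps)
  have TT': "T (T' y) = y" for y
  proof -
    have "T (T' y) = (\<alpha> * (cnj \<alpha> * y - cnj \<beta> * cnj y) + cnj \<beta> * (\<alpha> * cnj y - \<beta> * y)) / J"
      by (simp add: T_def T'_def cnjJ add_divide_distrib)
    also have "\<dots> = y"
      unfolding nonzero_divide_eq_eq[OF J0] by (simp add: Jeq algebra_simps)
    finally show ?thesis .
  qed

  have powi: "w powi (int m - int n) = w ^ m / w ^ n" if "w \<noteq> 0" for w :: complex and m
    using that by (simp add: power_int_diff)
  \<comment> \<open>Multiplying by \<open>w ^ n\<close> gives a power series whose constant
    coefficient is that of the pole of order \<open>n\<close>.\<close>
  have series: "summable (\<lambda>m. c (int m - int n) * w ^ m)"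
    "(\<Sum>m. c (int m - int n) * w powi (int m - int n)) = (\<Sum>m. c (int m - int n) * w ^ m) / w ^ n"
    if "w \<noteq> 0" "summable (\<lambda>m. c (int m - int n) * w powi (int m - int n))"
    for c :: "int \<Rightarrow> complex" and w
  proof -
    have "summable (\<lambda>m. c (int m - int n) * w ^ m / w ^ n)"
      using that by (simp add: powi)
    then show s: "summable (\<lambda>m. c (int m - int n) * w ^ m)"
      using summable_mult2[of _ "w ^ n"] that by fastforce
    then show "(\<Sum>m. c (int m - int n) * w powi (int m - int n))
        = (\<Sum>m. c (int m - int n) * w ^ m) / w ^ n"
      using suminf_divide[OF s, of "w ^ n"] that by (simp add: powi)
  qed
  have conv_a': "summable (\<lambda>m. a (int m - int n) * w ^ m)" if "0 < cmod w" "cmod w < r" for w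
    using series(1)[of w a] conv_a[of "w + z0"] that by simp
  have conv_b': "summable (\<lambda>m. b (int m - int n) * w ^ m)" if "0 < cmod w" "cmod w < r" for w
    using series(1)[of w b] conv_b[of "w + z0"] that by simp
  obtain p p' where p:
    "\<And>w. 0 < cmod w \<Longrightarrow> cmod w < r \<Longrightarrow> (\<Sum>m. a (int m - int n) * w ^ m) / w ^ n = \<alpha> / w ^ n + p w"
    "\<And>w. 0 < cmod w \<Longrightarrow> cmod w < r \<Longrightarrow> (p has_field_derivative p' w) (at w)"
    "((\<lambda>w. w ^ n * p w) \<longlongrightarrow> 0) (at 0)"
    "((\<lambda>w. w ^ (n + 1) * p' w) \<longlongrightarrow> 0) (at 0)"
    using pole_tail_asymptotics[OF r_pos conv_a'] unfolding \<alpha>_def by auto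
  obtain q q' where q:
    "\<And>w. 0 < cmod w \<Longrightarrow> cmod w < r \<Longrightarrow> (\<Sum>m. b (int m - int n) * w ^ m) / w ^ n = \<beta> / w ^ n + q w"
    "\<And>w. 0 < cmod w \<Longrightarrow> cmod w < r \<Longrightarrow> (q has_field_derivative q' w) (at w)"
    "((\<lambda>w. w ^ n * q w) \<longlongrightarrow> 0) (at 0)"
    "((\<lambda>w. w ^ (n + 1) * q' w) \<longlongrightarrow> 0) (at 0)"
    using pole_tail_asymptotics[OF r_pos conv_b'] unfolding \<beta>_def by auto
  define l :: "complex \<Rightarrow> complex \<Rightarrow> real" where "l = (\<lambda>w v. inner v (sgn w) / cmod w)"
  have l: "((\<lambda>w. ln (cmod w)) has_derivative l w) (at w)" "\<bar>l w v\<bar> \<le> cmod v / cmod w"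
    if "w \<noteq> 0" for w v
    unfolding l_def using that by (rule has_derivative_ln_norm, rule ln_norm_derivative_bound)
  \<comment> \<open>The coefficients \<open>a 0\<close> and \<open>b 0\<close> sit inside
    \<open>p\<close> and \<open>q\<close>. Subtracting \<open>k\<close> moves them to the right-hand
    side, so that the equation reads \<open>T (1 / w ^ n) + g w = \<eta> - k\<close>; as
    \<open>n \<ge> 1\<close>, \<open>w ^ n * k\<close> still tends to 0.\<close>
  define g where "g = (\<lambda>w. p w + cnj (q w) + 2 * A * of_real (ln (cmod w)) - k)"
  define g' where "g' = (\<lambda>w v. p' w * v + cnj (q' w * v) + 2 * A * of_real (l w v))"
  \<comment> \<open>Multiplied by \<open>cmod w ^ (n + 1)\<close>, the logarithmic part leaves
    \<open>2 * cmod A * cmod w ^ n\<close>, which vanishes at 0.\<close>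
  define D where "D = (\<lambda>w. cmod (p' w) + cmod (q' w) + 2 * cmod A / cmod w)"
  have f: "f z = T (1 / (z - z0) ^ n) + g (z - z0) + k"
    if z: "0 < cmod (z - z0)" "cmod (z - z0) < r" for z
    using f_eq[OF z] series(2)[of "z - z0" a, OF _ conv_a[OF z]]
      series(2)[of "z - z0" b, OF _ conv_b[OF z]] z p(1)[OF z] q(1)[OF z]
    by (simp add: T_def g_def)
  have der: "(g has_derivative g' w) (at w)" if w: "0 < cmod w" "cmod w < r" for w
  proof -
    have 1: "(p has_derivative (\<lambda>v. p' w * v)) (at w)"
      using p(2)[OF w] by (simp add: has_field_derivative_def)
    have 3: "((\<lambda>w. cnj (q w)) has_derivative (\<lambda>v. cnj (q' w * v))) (at w)"
      using q(2)[OF w] unfolding has_field_derivative_def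
      by (rule bounded_linear.has_derivative[OF bounded_linear_cnj])
    have 2: "((\<lambda>w. complex_of_real (ln (cmod w))) has_derivative (\<lambda>v. of_real (l w v))) (at w)"
      using l(1)[of w] w by (intro bounded_linear.has_derivative[OF bounded_linear_of_real]) auto
    show ?thesis
      unfolding g_def g'_def
      by (rule has_derivative_diff[OF has_derivative_add[OF has_derivative_add[OF 1 3]
            has_derivative_mult_right[OF 2]] has_derivative_const, simplified diff_0_right])
  qed
  have bound: "cmod (g' w v) \<le> D w * cmod v" if w: "0 < cmod w" "cmod w < r" for w v
  proof -
    have "cmod (g' w v) \<le> cmod (p' w * v) + cmod (cnj (q' w * v)) + cmod (2 * A * of_real (l w v))"
      unfolding g'_def by (intro norm_triangle_le add_mono) auto
    also have "\<dots> \<le> cmod (p' w) * cmod v + cmod (q' w) * cmod v + 2 * cmod A * (cmod v / cmod w)"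
      using mult_left_mono[OF l(2)[of w v], of "2 * cmod A"] w by (simp add: norm_mult)
    also have "\<dots> = D w * cmod v"
      by (simp add: D_def algebra_simps)
    finally show ?thesis .
  qed
  have pow0: "((\<lambda>w::complex. w ^ n) \<longlongrightarrow> 0) (at 0)"
    using n_ge by (auto intro!: tendsto_eq_intros)
  have cn: "((\<lambda>w. w ^ n * cnj (q w)) \<longlongrightarrow> 0) (at 0)"
    using tendsto_norm[OF q(3)] by (subst tendsto_norm_zero_iff[symmetric]) (simp add: norm_mult)
  have lim0: "((\<lambda>w. w ^ n * g w) \<longlongrightarrow> 0) (at 0)"
  proof -
    have "((\<lambda>w. w ^ n * p w + w ^ n * cnj (q w) + 2 * A * (w ^ n * of_real (ln (cmod w))) - w ^ n * k)
        \<longlongrightarrow> 0 + 0 + 2 * A * 0 - 0 * k) (at 0)"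
      by (intro tendsto_intros p cn pow0 power_mult_ln_norm_tendsto_0 n_ge)
    then show ?thesis
      by (simp add: g_def algebra_simps)
  qed
  have lim1: "((\<lambda>w. cmod w ^ (n + 1) * D w) \<longlongrightarrow> 0) (at 0)"
  proof -
    have "((\<lambda>w. cmod (w ^ (n + 1) * p' w) + cmod (w ^ (n + 1) * q' w) + 2 * cmod A * cmod (w ^ n))
        \<longlongrightarrow> 0 + 0 + 2 * cmod A * 0) (at 0)"
      by (intro tendsto_intros tendsto_norm_zero p q pow0)
    moreover have "\<forall>\<^sub>F w in at 0. cmod (w ^ (n + 1) * p' w) + cmod (w ^ (n + 1) * q' w)
        + 2 * cmod A * cmod (w ^ n) = cmod w ^ (n + 1) * D w"
      by (rule eventually_at_filter[THEN iffD2])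
        (auto simp: D_def norm_mult norm_power algebra_simps)
    ultimately show ?thesis
      by (simp add: Lim_transform_eventually)
  qed
  have inv: "J / (cnj \<alpha> * c - cnj \<beta> * cnj c) = 1 / T' c" for c
    by (simp add: T'_def)
  show ?thesis
    unfolding \<alpha>_def[symmetric] \<beta>_def[symmetric] k_def[symmetric] J_def[symmetric] inv
    by (rule pole_perturbation_newton[OF T T' T'T TT' n_ge r_pos der bound lim0 lim1 f])
qed

end
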